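(* For each lattice $\Lambda\subset\mathbb{R}^m$ (of rank $n\geq 1$), there exists a basis $B=\{\mathbf{b}_1,\dots,\mathbf{b}_n\}$ of $\Lambda$ that is strongly reduced.
   Context: A lattice $\Lambda$ of rank $n$ is a discrete subgroup of $\mathbb{R}^m$ which is the $\mathbb{Z}$-span of an (ordered) basis $B=\{\mathbf{b}_1,\dots,\mathbf{b}_n\}$ of $\mathbb{R}$-linearly independent vectors, $1\le n\leq m$. $\|\cdot\|$ is the Euclidean norm. For $1\le i\le n$, the $i$th successive minimum $\lambda_i$ of $\Lambda$ is the smallest real $r>0$ such that the closed ball of radius $r$ centred at the origin contains at least $i$ linearly independent vectors of $\Lambda$. An ordered basis $B=\{\mathbf{b}_1,\dots,\mathbf{b}_n\}$ of $\Lambda$ is called strongly reduced if both of the following hold: (1) There exist linearly independent lattice vectors $\mathbf{v}_1,\dots,\mathbf{v}_n\in\Lambda$ with $\|\mathbf{v}_i\|=\lambda_i$ for all $1\leq i\leq n$ such that, writing $\mathbf{v}_i=\sum_{j=1}^n x_j^{(i)}\mathbf{b}_j$ with $x_j^{(i)}\in\mathbb{Z}$, one has $x_i^{(i)}\neq 0$ and $x_{i+1}^{(i)}=x_{i+2}^{(i)}=\dots=x_n^{(i)}=0$ for every $1\leq i\leq n$. (2) For all $1\leq i\leq n$ and all $x_1,\dots,x_{i-1}\in\mathbb{Z}$, $\|\mathbf{b}_i\|\leq\left\|\mathbf{b}_i+\sum_{j=1}^{i-1}x_j\mathbf{b}_j\right\|$. *)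

theory Defs
  imports "HOL-Analysis.Analysis"
begin

text \<open>
  Finite families of vectors are functions on \<open>nat\<close> of which only the values at the indices
  \<open>1, \<dots>, n\<close> matter.
\<close>

definition lin_indep_family :: "nat \<Rightarrow> (nat \<Rightarrow> 'a::euclidean_space) \<Rightarrow> bool" where
  "lin_indep_family n v \<longleftrightarrow> inj_on v {1..n} \<and> independent (v ` {1..n})"

definition int_span :: "nat \<Rightarrow> (nat \<Rightarrow> 'a::euclidean_space) \<Rightarrow> 'a set" where
  "int_span n b = {\<Sum>j=1..n. real_of_int (x j) *\<^sub>R b j | x. True}"

definition lattice_basis :: "'a::euclidean_space set \<Rightarrow> nat \<Rightarrow> (nat \<Rightarrow> 'a) \<Rightarrow> bool" where
  "lattice_basis \<Lambda> n b \<longleftrightarrow> lin_indep_family n b \<and> \<Lambda> = int_span n b"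

definition additive_subgroup :: "'a::ab_group_add set \<Rightarrow> bool" where
  "additive_subgroup G \<longleftrightarrow>
     0 \<in> G \<and> (\<forall>x\<in>G. \<forall>y\<in>G. x + y \<in> G) \<and> (\<forall>x\<in>G. - x \<in> G)"

text \<open>
  The bound \<open>n \<le> DIM('a)\<close> follows from linear independence. The first two conjuncts are
  implied by the existence of a basis; they are kept to match the usual definition.
\<close>

definition euclidean_lattice :: "'a::euclidean_space set \<Rightarrow> nat \<Rightarrow> bool" where
  "euclidean_lattice \<Lambda> n \<longleftrightarrow>
     additive_subgroup \<Lambda> \<and> discrete \<Lambda> \<and> 1 \<le> n \<and> (\<exists>b. lattice_basis \<Lambda> n b)"

text \<open>
  The \<open>i\<close>-th successive minimum, meaningful for \<open>i\<close> between \<open>1\<close> and the rank; outside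
  this range the value is irrelevant.
\<close>

definition successive_minimum :: "'a::euclidean_space set \<Rightarrow> nat \<Rightarrow> real" where
  "successive_minimum \<Lambda> i =
     (LEAST r. 0 < r \<and> (\<exists>S. S \<subseteq> \<Lambda> \<inter> cball 0 r \<and> independent S \<and> i \<le> card S))"

definition strongly_reduced :: "'a::euclidean_space set \<Rightarrow> nat \<Rightarrow> (nat \<Rightarrow> 'a) \<Rightarrow> bool" where
  "strongly_reduced \<Lambda> n b \<longleftrightarrow>
     lattice_basis \<Lambda> n b \<and>
     (\<exists>(v :: nat \<Rightarrow> 'a) (x :: nat \<Rightarrow> nat \<Rightarrow> int).
        lin_indep_family n v \<and>
        (\<forall>i\<in>{1..n}.
           v i \<in> \<Lambda> \<and>
           norm (v i) = successive_minimum \<Lambda> i \<and>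
           v i = (\<Sum>j=1..n. real_of_int (x i j) *\<^sub>R b j) \<and>
           x i i \<noteq> 0 \<and> (\<forall>j\<in>{i+1..n}. x i j = 0))) \<and>
     (\<forall>i\<in>{1..n}. \<forall>x :: nat \<Rightarrow> int.
        norm (b i) \<le> norm (b i + (\<Sum>j=1..<i. real_of_int (x j) *\<^sub>R b j)))"

end

theory Submission
  imports Defs
begin

text \<open>
  The successive minima are attained by a greedy choice: let \<open>v\<^sub>i\<close> be a shortest lattice vector
  outside \<open>V\<^bsub>i-1\<^esub> = span {v\<^sub>1, \<dots>, v\<^bsub>i-1\<^esub>}\<close>. Any \<open>i\<close> independent lattice vectors
  include one outside \<open>V\<^bsub>i-1\<^esub>\<close>, since that space has dimension \<open>i - 1\<close>; so no ball smaller than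
  the one of radius \<open>\<parallel>v\<^sub>i\<parallel>\<close> can contain \<open>i\<close> of them
  (\<open>norm_greedy_eq_successive_minimum\<close>).

  The \<open>v\<^sub>i\<close> need not generate \<open>\<Lambda>\<close>, but they determine a flag of subspaces \<open>V\<^sub>i\<close>, and a basis
  adapted to this flag satisfies the triangularity condition on the coordinates of the \<open>v\<^sub>i\<close>.
  It is found one vector at a time. The group \<open>\<Lambda> \<inter> V\<^sub>i\<close> modulo \<open>\<Lambda> \<inter> V\<^bsub>i-1\<^esub>\<close>
  embeds into the reals through the coefficient of \<open>v\<^sub>i\<close>, with discrete image, and is therefore
  infinite cyclic. All lifts of a generator have the form \<open>b + z\<close> with
  \<open>z \<in> \<Lambda> \<inter> V\<^bsub>i-1\<^esub>\<close>, and a shortest one is taken as \<open>b\<^sub>i\<close>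
  (\<open>ex_shortest_complement_generator\<close>). Being a generator makes \<open>b\<^sub>1, \<dots>, b\<^sub>i\<close> a basis of
  \<open>\<Lambda> \<inter> V\<^sub>i\<close> (\<open>int_span_eq_Int_span\<close>), and being shortest among its lifts is the minimality
  of \<open>\<parallel>b\<^sub>i\<parallel>\<close> modulo \<open>b\<^sub>1, \<dots>, b\<^bsub>i-1\<^esub>\<close>. The two choices do not interfere, because adding
  elements of \<open>\<Lambda> \<inter> V\<^bsub>i-1\<^esub>\<close> changes neither the generator nor the flag.
\<close>

section \<open>Discrete subgroups\<close>

lemma additive_subgroup_diff:
  assumes "additive_subgroup L" "x \<in> L" "y \<in> L"
  shows "x - y \<in> L"
  using assms unfolding additive_subgroup_def by (metis diff_conv_add_uminus)

lemma additive_subgroup_int_scale: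
  fixes x :: "'a::real_vector"
  assumes "additive_subgroup L" "x \<in> L"
  shows "real_of_int k *\<^sub>R x \<in> L"
proof (induction k rule: int_induct[where k = 0])
  case base
  then show ?case using assms by (simp add: additive_subgroup_def)
next
  case (step1 i)
  then show ?case using assms by (simp add: additive_subgroup_def scaleR_add_left)
next
  case (step2 i)
  then show ?case using assms by (simp add: additive_subgroup_diff scaleR_diff_left)
qed

lemma additive_subgroup_int_combination:
  fixes f :: "'i \<Rightarrow> 'a::real_vector"
  assumes "additive_subgroup L" "\<And>i. i \<in> I \<Longrightarrow> f i \<in> L"
  shows "(\<Sum>i\<in>I. real_of_int (x i) *\<^sub>R f i) \<in> L"
  using assms(2)
proof (induction I rule: infinite_finite_induct)
  case (insert i I)
  then show ?case
    using assms(1) additive_subgroup_int_scale[OF assms(1)] by (simp add: additive_subgroup_def)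
qed (use assms(1) in \<open>auto simp: additive_subgroup_def\<close>)

text \<open>
  In a subgroup the isolation radius of \<open>0\<close> separates any two elements, by translation, so
  discreteness is uniform and excludes accumulation points even outside the subgroup.
\<close>
lemma additive_subgroup_discrete_finite_cball:
  fixes L :: "'a::euclidean_space set"
  assumes "additive_subgroup L" "discrete L"
  shows "finite (L \<inter> cball 0 r)"
proof -
  have "0 isolated_in L"
    using assms by (auto simp: discrete_def additive_subgroup_def)
  then obtain d where d: "d > 0" "\<And>y. y \<in> L \<Longrightarrow> dist 0 y < d \<Longrightarrow> y = 0"
    by (rule isolated_inE_dist) blast
  have "uniform_discrete L"
  proof (rule uniformI1[OF d(1)])
    fix x y assume xy: "x \<in> L" "y \<in> L" "dist x y < d"
    then have "x - y = 0"
      by (intro d(2) additive_subgroup_diff assms(1)) (auto simp: dist_norm norm_minus_commute)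
    then show "x = y" by simp
  qed
  then have "uniform_discrete (L \<inter> cball 0 r)" by (rule uniform_discrete_subset) blast
  moreover have "bounded (L \<inter> cball 0 r)" by (simp add: bounded_Int)
  ultimately show ?thesis using uniform_discrete_finite_iff by blast
qed

lemma ex_shortest_vector:
  fixes L :: "'a::real_normed_vector set"
  assumes fin: "\<And>r. finite (L \<inter> cball 0 r)" and "E \<subseteq> L" "E \<noteq> {}"
  shows "\<exists>b\<in>E. \<forall>y\<in>E. norm b \<le> norm y"
proof -
  obtain e where e: "e \<in> E" using \<open>E \<noteq> {}\<close> by blast
  let ?F = "E \<inter> cball 0 (norm e)"
  have "finite ?F" using \<open>E \<subseteq> L\<close> by (intro finite_subset[OF _ fin[of "norm e"]]) auto
  moreover have "?F \<noteq> {}" using e by auto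
  ultimately obtain b where b: "is_arg_min norm (\<lambda>y. y \<in> ?F) b"
    using ex_is_arg_min_if_finite by blast
  show ?thesis
  proof (intro bexI ballI)
    show "b \<in> E" using b by (auto simp: is_arg_min_def)
    fix y assume "y \<in> E"
    then show "norm b \<le> norm y"
      using b e by (cases "norm y \<le> norm e") (auto simp: is_arg_min_linorder)
  qed
qed

text \<open>
  Rounding the coordinates down leaves a remainder in the fundamental parallelepiped of \<open>C\<close>.
  This turns searches over infinitely many cosets into searches in a bounded region.
\<close>
lemma ex_round_to_subgroup:
  fixes L :: "'a::real_normed_vector set"
  assumes "additive_subgroup L" "finite C" "C \<subseteq> L" "w \<in> span C"
  shows "\<exists>u \<in> L \<inter> span C. norm (w - u) \<le> (\<Sum>c\<in>C. norm c)"
proof -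
  obtain a where a: "w = (\<Sum>c\<in>C. a c *\<^sub>R c)"
    using assms(4) by (auto simp: span_finite[OF assms(2)])
  define u where "u = (\<Sum>c\<in>C. real_of_int \<lfloor>a c\<rfloor> *\<^sub>R c)"
  have "u \<in> L"
    unfolding u_def using assms(3) by (intro additive_subgroup_int_combination assms(1)) auto
  moreover have "u \<in> span C"
    unfolding u_def by (intro span_sum span_scale span_base)
  moreover have "norm (w - u) \<le> (\<Sum>c\<in>C. norm c)"
  proof -
    have "w - u = (\<Sum>c\<in>C. frac (a c) *\<^sub>R c)"
      by (simp add: a u_def frac_def scaleR_diff_left sum_subtractf)
    also have "norm \<dots> \<le> (\<Sum>c\<in>C. norm c)"
      by (intro sum_norm_le) (simp add: abs_of_nonneg frac_lt_1 less_imp_le mult_left_le_one_le)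
    finally show ?thesis .
  qed
  ultimately show ?thesis by blast
qed

section \<open>Extending a basis by one short vector\<close>

text \<open>
  Let \<open>\<phi>\<close> be the coefficient of \<open>v\<close> on \<open>span (insert v C)\<close>; its kernel is \<open>span C\<close>.
  Modulo \<open>L \<inter> span C\<close>, every element of \<open>L \<inter> span (insert v C)\<close> with \<open>0 < \<phi> \<le> 1\<close> has a
  representative in a fixed ball. Hence \<open>\<phi>\<close> takes only finitely many such values and has a least
  positive value \<open>\<alpha>\<close>, and Euclidean division by \<open>\<alpha>\<close> shows that an element with \<open>\<phi> = \<alpha>\<close>
  generates the quotient. Among these, the shortest is chosen.
\<close>
lemma ex_shortest_complement_generator:
  fixes L :: "'a::euclidean_space set"
  assumes L: "additive_subgroup L" and fin: "\<And>r. finite (L \<inter> cball 0 r)"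
    and C: "independent C" "C \<subseteq> L" and v: "v \<in> L" "v \<notin> span C"
  shows "\<exists>b \<in> L \<inter> span (insert v C) - span C.
           (\<forall>y \<in> L \<inter> span (insert v C). \<exists>k. y - real_of_int k *\<^sub>R b \<in> span C) \<and>
           (\<forall>z \<in> L \<inter> span C. norm b \<le> norm (b + z))"
proof -
  define M where "M = L \<inter> span (insert v C)"
  have finC: "finite C" using C(1) by (rule independent_imp_finite)
  have "independent (insert v C)" using C(1) v(2) by (rule independent_insertI[rotated])
  from linear_independent_extend[OF this, of "\<lambda>y. if y = v then 1 else (0::real)"]
  obtain \<phi> :: "'a \<Rightarrow> real"
    where lin: "linear \<phi>" and \<phi>: "\<forall>y\<in>insert v C. \<phi> y = (if y = v then 1 else 0)" by blast
  have \<phi>v: "\<phi> v = 1" using \<phi> by simp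
  have \<phi>C: "\<phi> y = 0" if "y \<in> span C" for y
  proof (rule linear_eq_0_on_span[OF lin _ that])
    fix c assume "c \<in> C"
    then show "\<phi> c = 0" using \<phi> v(2) span_base[of c C] by auto
  qed
  have remainder: "y - \<phi> y *\<^sub>R v \<in> span C" if y: "y \<in> span (insert v C)" for y
  proof -
    obtain k where k: "y - k *\<^sub>R v \<in> span C" using y by (auto simp: span_breakdown_eq)
    from \<phi>C[OF this] have "\<phi> y = k"
      using \<phi>v by (simp add: linear_diff[OF lin] linear_scale[OF lin])
    with k show ?thesis by simp
  qed
  have ker: "y \<in> span C" if "y \<in> M" "\<phi> y = 0" for y
    using remainder[of y] that by (simp add: M_def)
  have C_sub: "span C \<subseteq> span (insert v C)" by (intro span_mono) auto
  have M: "y - real_of_int k *\<^sub>R z \<in> M" if "y \<in> M" "z \<in> M" for y z k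
    using that additive_subgroup_diff[OF L] additive_subgroup_int_scale[OF L]
    by (simp add: M_def span_diff span_scale)

  \<comment> \<open>The radius is the bound on remainders from rounding along \<open>C\<close> plus one for the \<open>v\<close>-part; it
      is large enough for \<open>D\<close> to meet every coset with \<open>0 < \<phi> \<le> 1\<close>, and small enough for \<open>D\<close>
      to be finite.\<close>
  define D where
    "D = {y \<in> M. 0 < \<phi> y \<and> \<phi> y \<le> 1 \<and> norm y \<le> norm v + (\<Sum>c\<in>C. norm c)}"
  have "D \<subseteq> L \<inter> cball 0 (norm v + (\<Sum>c\<in>C. norm c))" by (auto simp: D_def M_def)
  then have "finite D" using fin finite_subset by blast
  moreover have "v \<in> D" using v(1) \<phi>v by (simp add: D_def M_def span_base sum_nonneg)
  ultimately obtain y\<^sub>0 where y\<^sub>0: "is_arg_min \<phi> (\<lambda>y. y \<in> D) y\<^sub>0"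
    using ex_is_arg_min_if_finite[of D \<phi>] by blast
  define \<alpha> where "\<alpha> = \<phi> y\<^sub>0"
  have y\<^sub>0_M: "y\<^sub>0 \<in> M" and \<alpha>: "0 < \<alpha>" "\<alpha> \<le> 1"
    using y\<^sub>0 by (auto simp: is_arg_min_def \<alpha>_def D_def)
  have min: "\<alpha> \<le> \<phi> y" if y: "y \<in> M" "0 < \<phi> y" for y
  proof (cases "\<phi> y \<le> 1")
    case True
    have "y - \<phi> y *\<^sub>R v \<in> span C" using y remainder by (simp add: M_def)
    from ex_round_to_subgroup[OF L finC C(2) this]
    obtain u where u: "u \<in> L" "u \<in> span C"
      "norm (y - \<phi> y *\<^sub>R v - u) \<le> (\<Sum>c\<in>C. norm c)" by blast
    have "norm (y - u) \<le> norm (\<phi> y *\<^sub>R v) + norm (y - \<phi> y *\<^sub>R v - u)"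
      using norm_triangle_ineq[of "\<phi> y *\<^sub>R v" "y - \<phi> y *\<^sub>R v - u"] by simp
    also have "\<dots> \<le> norm v + (\<Sum>c\<in>C. norm c)"
      using u(3) True y(2) by (intro add_mono) (auto intro: mult_left_le_one_le)
    finally have "norm (y - u) \<le> norm v + (\<Sum>c\<in>C. norm c)" .
    moreover have "y - u \<in> M" using M[of y u 1] y(1) u C_sub by (auto simp: M_def)
    moreover have \<phi>_eq: "\<phi> (y - u) = \<phi> y" using \<phi>C[OF u(2)] by (simp add: linear_diff[OF lin])
    ultimately have "y - u \<in> D" using y True by (simp add: D_def)
    then show ?thesis using y\<^sub>0 \<phi>_eq by (auto simp: is_arg_min_linorder \<alpha>_def)
  qed (use \<alpha> in simp)

  obtain b where b: "b \<in> M" "\<phi> b = \<alpha>" and short: "\<And>y. y \<in> M \<Longrightarrow> \<phi> y = \<alpha> \<Longrightarrow> norm b \<le> norm y"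
    using ex_shortest_vector[OF fin, of "{y \<in> M. \<phi> y = \<alpha>}"] y\<^sub>0_M \<alpha>_def
    by (auto simp: M_def)
  have "b \<notin> span C" using \<phi>C[of b] b \<alpha> by auto
  moreover have "\<exists>k. y - real_of_int k *\<^sub>R b \<in> span C" if y: "y \<in> M" for y
  proof
    define k where "k = \<lfloor>\<phi> y / \<alpha>\<rfloor>"
    let ?r = "y - real_of_int k *\<^sub>R b"
    have r: "\<phi> ?r = frac (\<phi> y / \<alpha>) * \<alpha>"
      using b \<alpha> by (simp add: linear_diff[OF lin] linear_scale[OF lin] k_def frac_def field_simps)
    have "\<not> \<alpha> \<le> \<phi> ?r" using \<alpha> frac_lt_1[of "\<phi> y / \<alpha>"] by (simp add: r)
    moreover have "0 \<le> \<phi> ?r" using \<alpha> by (simp add: r)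
    moreover have r_M: "?r \<in> M" using M y b(1) by blast
    ultimately have "\<phi> ?r = 0" using min[of ?r] by linarith
    then show "?r \<in> span C" using ker r_M by blast
  qed
  moreover have "norm b \<le> norm (b + z)" if z: "z \<in> L \<inter> span C" for z
  proof (rule short)
    show "b + z \<in> M"
      using b(1) z L C_sub by (auto simp: M_def additive_subgroup_def intro: span_add)
    show "\<phi> (b + z) = \<alpha>" using \<phi>C[of z] z b by (simp add: linear_add[OF lin])
  qed
  ultimately show ?thesis using b(1) by (auto simp: M_def intro!: bexI[of _ b])
qed

section \<open>Successive minima\<close>

lemma lin_indep_familyI:
  assumes "\<And>i. i \<in> {1..n} \<Longrightarrow> v i \<notin> span (v ` {1..<i})"
  shows "lin_indep_family n v"
  using assms
proof (induction n)
  case 0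
  then show ?case by (simp add: lin_indep_family_def independent_empty)
next
  case (Suc n)
  have IH: "lin_indep_family n v" using Suc by simp
  have new: "v (Suc n) \<notin> span (v ` {1..n})"
    using Suc.prems[of "Suc n"] by (simp add: atLeastLessThanSuc_atLeastAtMost)
  then have "v (Suc n) \<notin> v ` {1..n}" by (rule contrapos_nn) (rule span_base)
  with new IH show ?case
    by (auto simp: lin_indep_family_def atLeastAtMostSuc_conv independent_insertI)
qed

lemma card_image_lin_indep_family:
  "lin_indep_family n v \<Longrightarrow> card (v ` {1..n}) = n"
  by (simp add: lin_indep_family_def card_image)

text \<open>
  The independent set \<open>S\<close> guarantees that \<open>L\<close> is not exhausted before \<open>n\<close> steps: fewer than
  \<open>n\<close> vectors cannot span it.
\<close>
lemma ex_greedy_family: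
  fixes L :: "'a::euclidean_space set"
  assumes fin: "\<And>r. finite (L \<inter> cball 0 r)"
    and S: "S \<subseteq> L" "independent S" "card S = n"
  shows "\<exists>v. \<forall>i\<in>{1..n}. v i \<in> L - span (v ` {1..<i}) \<and>
               (\<forall>y \<in> L - span (v ` {1..<i}). norm (v i) \<le> norm y)"
proof -
  let ?P = "\<lambda>v i. v i \<in> L - span (v ` {1..<i}) \<and>
               (\<forall>y \<in> L - span (v ` {1..<i}). norm (v i) \<le> norm y)"
  have "m \<le> n \<Longrightarrow> \<exists>v. \<forall>i\<in>{1..m}. ?P v i" for m
  proof (induction m)
    case 0
    then show ?case by simp
  next
    case (Suc m)
    then obtain v where v: "\<forall>i\<in>{1..m}. ?P v i" by auto
    let ?E = "L - span (v ` {1..m})"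
    have "\<not> S \<subseteq> span (v ` {1..m})"
    proof
      assume "S \<subseteq> span (v ` {1..m})"
      then have "card S \<le> card (v ` {1..m})" using independent_span_bound[OF _ S(2)] by blast
      also have "\<dots> \<le> m" using card_image_le[of "{1..m}" v] by simp
      finally show False using S(3) Suc.prems by simp
    qed
    then have "?E \<noteq> {}" using S(1) by blast
    from ex_shortest_vector[OF fin _ this]
    obtain w where w: "w \<in> ?E" "\<forall>y\<in>?E. norm w \<le> norm y" by auto
    have img: "(v(Suc m := w)) ` {1..<i} = v ` {1..<i}" if "i \<le> Suc m" for i
      using that by (intro image_cong) auto
    have "?P (v(Suc m := w)) i" if i: "i \<in> {1..Suc m}" for i
    proof (cases "i = Suc m")
      case True
      then show ?thesis
        using w img[of i] by (simp only: atLeastLessThanSuc_atLeastAtMost fun_upd_same)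
    next
      case False
      then show ?thesis using v i img[of i] by auto
    qed
    then show ?case by blast
  qed
  then show ?thesis by blast
qed

text \<open>
  The greedy norms increase, because \<open>v i\<close> was already a candidate at each earlier step; so the
  ball of radius \<open>norm (v i)\<close> contains \<open>v 1, \<dots>, v i\<close>. Conversely, \<open>i\<close> independent vectors do
  not fit into the span of \<open>i - 1\<close> vectors, so one of them competes with \<open>v i\<close>.
\<close>
lemma norm_greedy_eq_successive_minimum:
  fixes L :: "'a::euclidean_space set"
  assumes v: "\<And>i. i \<in> {1..n} \<Longrightarrow> v i \<in> L - span (v ` {1..<i})"
    and greedy: "\<And>i y. i \<in> {1..n} \<Longrightarrow> y \<in> L - span (v ` {1..<i}) \<Longrightarrow> norm (v i) \<le> norm y"
    and i: "i \<in> {1..n}"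
  shows "norm (v i) = successive_minimum L i"
proof -
  have "(LEAST r. 0 < r \<and> (\<exists>S. S \<subseteq> L \<inter> cball 0 r \<and> independent S \<and> i \<le> card S)) = norm (v i)"
  proof (rule Least_equality, intro conjI exI)
    show "0 < norm (v i)" using v[OF i] span_zero[of "v ` {1..<i}"] by auto
    show "v ` {1..i} \<subseteq> L \<inter> cball 0 (norm (v i))"
    proof
      fix y assume "y \<in> v ` {1..i}"
      then obtain j where j: "j \<in> {1..i}" "y = v j" by blast
      have "span (v ` {1..<j}) \<subseteq> span (v ` {1..<i})" using j by (intro span_mono) auto
      then have "norm (v j) \<le> norm (v i)" using v[OF i] i j by (intro greedy) auto
      then show "y \<in> L \<inter> cball 0 (norm (v i))" using v[of j] i j by auto
    qed
    have indep: "lin_indep_family i v" using v i by (intro lin_indep_familyI) auto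
    then show "independent (v ` {1..i})" by (simp add: lin_indep_family_def)
    show "i \<le> card (v ` {1..i})" using card_image_lin_indep_family[OF indep] by simp
  next
    fix r assume "0 < r \<and> (\<exists>S. S \<subseteq> L \<inter> cball 0 r \<and> independent S \<and> i \<le> card S)"
    then obtain S where S: "S \<subseteq> L \<inter> cball 0 r" "independent S" "i \<le> card S" by blast
    have "\<not> S \<subseteq> span (v ` {1..<i})"
    proof
      assume "S \<subseteq> span (v ` {1..<i})"
      then have "card S \<le> card (v ` {1..<i})" using independent_span_bound[OF _ S(2)] by blast
      also have "\<dots> \<le> i - 1" using card_image_le[of "{1..<i}" v] by simp
      finally have "card S < i" using i by (cases i) auto
      with S(3) show False by simp
    qed
    then obtain s where s: "s \<in> S" "s \<notin> span (v ` {1..<i})" by blast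
    then have "norm (v i) \<le> norm s" using S(1) by (intro greedy[OF i]) auto
    also have "\<dots> \<le> r" using s S(1) by auto
    finally show "norm (v i) \<le> r" .
  qed
  then show ?thesis by (simp add: successive_minimum_def)
qed

section \<open>Bases adapted to a flag\<close>

text \<open>
  \<open>L\<close> spans a space of dimension \<open>n\<close>, which \<open>n\<close> independent vectors of \<open>L\<close> must fill.
\<close>
lemma lattice_subset_span:
  fixes L :: "'a::euclidean_space set"
  assumes "lattice_basis L n c" "lin_indep_family n v" "v ` {1..n} \<subseteq> L"
  shows "L \<subseteq> span (v ` {1..n})"
proof -
  have L: "L \<subseteq> span (c ` {1..n})"
  proof
    fix y assume "y \<in> L"
    then obtain x :: "nat \<Rightarrow> int" where "y = (\<Sum>j=1..n. real_of_int (x j) *\<^sub>R c j)"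
      using assms(1) by (auto simp: lattice_basis_def int_span_def)
    then show "y \<in> span (c ` {1..n})" by (simp only:) (intro span_sum span_scale span_base imageI)
  qed
  have "dim (span (c ` {1..n})) = card (v ` {1..n})"
    using assms(1,2)
    by (simp add: lattice_basis_def lin_indep_family_def dim_eq_card_independent card_image)
  moreover have "independent (v ` {1..n})" using assms(2) by (simp add: lin_indep_family_def)
  ultimately have "span (c ` {1..n}) \<subseteq> span (v ` {1..n})"
    using assms(3) L by (intro card_ge_dim_independent[where V = "span (c ` {1..n})"]) (blast, simp_all)
  with L show ?thesis by blast
qed

lemma int_span_Suc:
  "int_span (Suc n) b = {u + real_of_int k *\<^sub>R b (Suc n) | u k. u \<in> int_span n b}"
proof (intro set_eqI iffI)
  fix y assume "y \<in> int_span (Suc n) b"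
  then show "y \<in> {u + real_of_int k *\<^sub>R b (Suc n) | u k. u \<in> int_span n b}"
    by (auto simp: int_span_def)
next
  fix y assume "y \<in> {u + real_of_int k *\<^sub>R b (Suc n) | u k. u \<in> int_span n b}"
  then obtain x k where y: "y = (\<Sum>j=1..n. real_of_int (x j) *\<^sub>R b j) + real_of_int k *\<^sub>R b (Suc n)"
    by (auto simp: int_span_def)
  have "y = (\<Sum>j=1..Suc n. real_of_int ((x(Suc n := k)) j) *\<^sub>R b j)"
    by (simp add: y)
  then show "y \<in> int_span (Suc n) b" unfolding int_span_def by blast
qed

text \<open>
  If each \<open>b i\<close> generates the \<open>i\<close>-th quotient of the filtration of \<open>L\<close> by the spans of the
  initial segments of \<open>v\<close>, then the coordinates of a lattice vector can be split off from the top
  down: subtracting the right multiple of \<open>b i\<close> leaves a lattice vector one level lower.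
\<close>
lemma int_span_eq_Int_span:
  fixes L :: "'a::euclidean_space set"
  assumes L: "additive_subgroup L"
    and b: "\<And>i. i \<in> {1..n} \<Longrightarrow> b i \<in> L \<inter> span (v ` {1..i})"
    and gen: "\<And>i y. i \<in> {1..n} \<Longrightarrow> y \<in> L \<inter> span (v ` {1..i}) \<Longrightarrow>
                \<exists>k. y - real_of_int k *\<^sub>R b i \<in> span (v ` {1..<i})"
  shows "m \<le> n \<Longrightarrow> int_span m b = L \<inter> span (v ` {1..m})"
proof (induction m)
  case 0
  then show ?case using L by (auto simp: int_span_def additive_subgroup_def)
next
  case (Suc m)
  then have IH: "int_span m b = L \<inter> span (v ` {1..m})" by simp
  have m: "Suc m \<in> {1..n}" using Suc by simp
  have mono: "span (v ` {1..m}) \<subseteq> span (v ` {1..Suc m})" by (intro span_mono) auto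
  show ?case
  proof (intro set_eqI iffI)
    fix y assume "y \<in> int_span (Suc m) b"
    then obtain u k where "y = u + real_of_int k *\<^sub>R b (Suc m)" "u \<in> L \<inter> span (v ` {1..m})"
      by (auto simp: int_span_Suc IH)
    then show "y \<in> L \<inter> span (v ` {1..Suc m})"
      using b[OF m] L mono additive_subgroup_int_scale[OF L, of "b (Suc m)" k]
      by (auto simp: additive_subgroup_def intro!: span_add span_scale)
  next
    fix y assume y: "y \<in> L \<inter> span (v ` {1..Suc m})"
    from gen[OF m this] obtain k where k: "y - real_of_int k *\<^sub>R b (Suc m) \<in> span (v ` {1..m})"
      by (auto simp: atLeastLessThanSuc_atLeastAtMost)
    moreover have "y - real_of_int k *\<^sub>R b (Suc m) \<in> L"
      using y b[OF m] by (auto intro: additive_subgroup_diff additive_subgroup_int_scale L)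
    ultimately have "y - real_of_int k *\<^sub>R b (Suc m) \<in> int_span m b" by (simp add: IH)
    then show "y \<in> int_span (Suc m) b"
      unfolding int_span_Suc by (intro CollectI exI[of _ "y - real_of_int k *\<^sub>R b (Suc m)"] exI[of _ k]) simp
  qed
qed

section \<open>Strongly reduced bases\<close>

theorem theorem3:
  fixes \<Lambda> :: "(real ^ 'm) set" and n :: nat
  assumes "euclidean_lattice \<Lambda> n"
  shows "\<exists>b. lattice_basis \<Lambda> n b \<and> strongly_reduced \<Lambda> n b"
proof -
  obtain c where L: "additive_subgroup \<Lambda>" and disc: "discrete \<Lambda>" and c: "lattice_basis \<Lambda> n c"
    using assms by (auto simp: euclidean_lattice_def)
  note fin = additive_subgroup_discrete_finite_cball[OF L disc]
  have "c ` {1..n} \<subseteq> \<Lambda>"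
  proof
    fix y assume "y \<in> c ` {1..n}"
    then obtain i where i: "i \<in> {1..n}" "y = c i" by blast
    have "(\<Sum>j=1..n. real_of_int (if j = i then 1 else 0) *\<^sub>R c j) = (\<Sum>j=1..n. if j = i then c j else 0)"
      by (intro sum.cong) auto
    also have "\<dots> = y" using i by simp
    finally have "y = (\<Sum>j=1..n. real_of_int (if j = i then 1 else 0) *\<^sub>R c j)" by (rule sym)
    then have "y \<in> int_span n c"
      unfolding int_span_def by (intro CollectI exI[of _ "\<lambda>j. if j = i then 1 else 0"]) simp
    then show "y \<in> \<Lambda>" using c by (simp add: lattice_basis_def)
  qed
  moreover have "independent (c ` {1..n})" "card (c ` {1..n}) = n"
    using c card_image_lin_indep_family by (auto simp: lattice_basis_def lin_indep_family_def)
  ultimately obtain v where v': "\<forall>i\<in>{1..n}. v i \<in> \<Lambda> - span (v ` {1..<i}) \<and>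
               (\<forall>y \<in> \<Lambda> - span (v ` {1..<i}). norm (v i) \<le> norm y)"
    using ex_greedy_family[OF fin] by blast
  then have
    v: "\<And>i. i \<in> {1..n} \<Longrightarrow> v i \<in> \<Lambda> - span (v ` {1..<i})" and
    greedy: "\<And>i y. i \<in> {1..n} \<Longrightarrow> y \<in> \<Lambda> - span (v ` {1..<i}) \<Longrightarrow> norm (v i) \<le> norm y"
    by auto
  have v_indep: "lin_indep_family i v" if "i \<le> n" for i
    using v that by (intro lin_indep_familyI) auto
  have flag: "v ` {1..i} = insert (v i) (v ` {1..<i})" if "i \<in> {1..n}" for i
    using that by (auto simp: image_iff) (metis atLeastLessThan_iff le_neq_implies_less)

  \<comment> \<open>The choice of each \<open>b i\<close> refers to the flag of the \<open>v i\<close> and not to the earlier \<open>b j\<close>,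
      so no recursion is involved.\<close>
  have "\<exists>b \<in> \<Lambda> \<inter> span (v ` {1..i}) - span (v ` {1..<i}).
           (\<forall>y \<in> \<Lambda> \<inter> span (v ` {1..i}). \<exists>k. y - real_of_int k *\<^sub>R b \<in> span (v ` {1..<i})) \<and>
           (\<forall>z \<in> \<Lambda> \<inter> span (v ` {1..<i}). norm b \<le> norm (b + z))" if i: "i \<in> {1..n}" for i
    unfolding flag[OF i]
  proof (rule ex_shortest_complement_generator[OF L fin])
    have "independent (v ` {1..i})" using v_indep i by (simp add: lin_indep_family_def)
    then show "independent (v ` {1..<i})" by (rule independent_mono) auto
    show "v ` {1..<i} \<subseteq> \<Lambda>" using v i by auto
  qed (use v[OF i] in auto)
  then obtain b where b': "\<forall>i\<in>{1..n}. b i \<in> \<Lambda> \<inter> span (v ` {1..i}) - span (v ` {1..<i}) \<and>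
           (\<forall>y \<in> \<Lambda> \<inter> span (v ` {1..i}). \<exists>k. y - real_of_int k *\<^sub>R b i \<in> span (v ` {1..<i})) \<and>
           (\<forall>z \<in> \<Lambda> \<inter> span (v ` {1..<i}). norm (b i) \<le> norm (b i + z))"
    unfolding Bex_def by (elim bchoice[THEN exE, rotated]) blast
  then have
    b: "\<And>i. i \<in> {1..n} \<Longrightarrow> b i \<in> \<Lambda> \<inter> span (v ` {1..i}) - span (v ` {1..<i})" and
    gen: "\<And>i y. i \<in> {1..n} \<Longrightarrow> y \<in> \<Lambda> \<inter> span (v ` {1..i}) \<Longrightarrow>
            \<exists>k. y - real_of_int k *\<^sub>R b i \<in> span (v ` {1..<i})" and
    short: "\<And>i z. i \<in> {1..n} \<Longrightarrow> z \<in> \<Lambda> \<inter> span (v ` {1..<i}) \<Longrightarrow> norm (b i) \<le> norm (b i + z)"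
    by blast+
  have span_b: "int_span m b = \<Lambda> \<inter> span (v ` {1..m})" if "m \<le> n" for m
    using b gen by (intro int_span_eq_Int_span[OF L _ _ that]) auto
  have b_flag: "span (b ` {1..<i}) \<subseteq> span (v ` {1..<i})" if i: "i \<in> {1..n}" for i
  proof (intro span_minimal subspace_span subsetI)
    fix y assume "y \<in> b ` {1..<i}"
    then obtain j where j: "j \<in> {1..<i}" "y = b j" by blast
    have "span (v ` {1..j}) \<subseteq> span (v ` {1..<i})" using j by (intro span_mono) auto
    then show "y \<in> span (v ` {1..<i})" using b[of j] i j by auto
  qed
  have "lin_indep_family n b"
    using b b_flag by (intro lin_indep_familyI) blast
  moreover have "\<Lambda> \<subseteq> span (v ` {1..n})"
    using v by (intro lattice_subset_span[OF c v_indep]) auto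
  then have "\<Lambda> = int_span n b" by (auto simp: span_b)
  ultimately have basis: "lattice_basis \<Lambda> n b" by (simp add: lattice_basis_def)

  have "\<exists>x. v i = (\<Sum>j=1..n. real_of_int (x j) *\<^sub>R b j) \<and> x i \<noteq> 0 \<and> (\<forall>j\<in>{i+1..n}. x j = 0)"
    if i: "i \<in> {1..n}" for i
  proof -
    have "v i \<in> span (v ` {1..i})" using i by (intro span_base imageI) simp
    then have "v i \<in> int_span i b" using i v[OF i] span_b[of i] by simp
    then obtain x where x: "v i = (\<Sum>j=1..i. real_of_int (x j) *\<^sub>R b j)"
      by (auto simp: int_span_def)
    define x' where "x' j = (if j \<le> i then x j else 0)" for j
    have "(\<Sum>j=1..n. real_of_int (x' j) *\<^sub>R b j) = (\<Sum>j=1..i. real_of_int (x j) *\<^sub>R b j)"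
      using i by (intro sum.mono_neutral_cong_right) (auto simp: x'_def)
    moreover have "x i \<noteq> 0"
    proof
      assume "x i = 0"
      then have "v i = (\<Sum>j=1..<i. real_of_int (x j) *\<^sub>R b j)"
        unfolding x using i by (intro sum.mono_neutral_right) auto
      also have "\<dots> \<in> span (b ` {1..<i})" by (intro span_sum span_scale span_base imageI)
      finally show False using b_flag[OF i] v[OF i] by blast
    qed
    ultimately show ?thesis using x by (intro exI[of _ x']) (auto simp: x'_def)
  qed
  then obtain x :: "nat \<Rightarrow> nat \<Rightarrow> int" where
    x: "\<And>i. i \<in> {1..n} \<Longrightarrow> v i = (\<Sum>j=1..n. real_of_int (x i j) *\<^sub>R b j) \<and> x i i \<noteq> 0 \<and>
          (\<forall>j\<in>{i+1..n}. x i j = 0)"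
    by metis
  have size_reduced: "norm (b i) \<le> norm (b i + (\<Sum>j=1..<i. real_of_int (y j) *\<^sub>R b j))"
    if i: "i \<in> {1..n}" for i and y :: "nat \<Rightarrow> int"
  proof (rule short[OF i], rule IntI)
    show "(\<Sum>j=1..<i. real_of_int (y j) *\<^sub>R b j) \<in> \<Lambda>"
      using b i by (intro additive_subgroup_int_combination L) auto
    have "(\<Sum>j=1..<i. real_of_int (y j) *\<^sub>R b j) \<in> span (b ` {1..<i})"
      by (intro span_sum span_scale span_base imageI)
    then show "(\<Sum>j=1..<i. real_of_int (y j) *\<^sub>R b j) \<in> span (v ` {1..<i})"
      using b_flag[OF i] by blast
  qed
  have "norm (v i) = successive_minimum \<Lambda> i" if "i \<in> {1..n}" for i
    using norm_greedy_eq_successive_minimum[OF v greedy that] by blast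
  then have "strongly_reduced \<Lambda> n b"
    unfolding strongly_reduced_def
    using basis v_indep[of n] v x size_reduced by (intro conjI exI[of _ v] exI[of _ x]) auto
  with basis show ?thesis by blast
qed

end
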